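(* Let $t_0\in\mathbb{R}$ and let $r>0$ be finite and fixed. Let $A(t)=\sum_{n=0}^\infty A_n(t-t_0)^n$ and $B(t)=\sum_{n=0}^\infty B_n(t-t_0)^n$ be power series convergent for $t\in(t_0-r,t_0+r)$ whose coefficients $A_0,A_1,\ldots,B_0,B_1,\ldots$ are deterministic real constants, and let $Y_0,Y_1\in\mathrm{L}^2(\Omega)$. Suppose that $Y_0$ is absolutely continuous with density function $f_{Y_0}$ and is independent of $Y_1$. If $f_{Y_0}$ has at most a countable number of discontinuities on $\mathbb{R}$, $f_{Y_0}(y)\le\alpha+\beta y^2$ for all $y\in\mathbb{R}$ for certain constants $\alpha,\beta\ge0$, and $Y_1$ is a discrete random variable, then, for each $t\in(t_0-\delta,t_0+\delta)$, $$\lim_{N\to\infty}f_{X^N(t)}(x)=f_{X(t)}(x)\quad\text{for almost every }x\in\mathbb{R}.$$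
   Context: $(\Omega,\mathcal{F},\mathbb{P})$ is a complete probability space; $\mathrm{L}^2(\Omega)$ is the space of real random variables with finite second moment. A discrete random variable is one supported on a countable set. $S_0(t)=\sum_{n\ge0}S_{0,n}(t-t_0)^n$ and $S_1(t)=\sum_{n\ge0}S_{1,n}(t-t_0)^n$ are the (here deterministic) power series, convergent for $t\in(t_0-r,t_0+r)$, with $S_{0,0}=1$, $S_{0,1}=0$, $S_{1,0}=0$, $S_{1,1}=1$ and, for $i\in\{0,1\}$ and $n\ge0$, $S_{i,n+2}=\frac{-1}{(n+2)(n+1)}\sum_{m=0}^n[(m+1)A_{n-m}S_{i,m+1}+B_{n-m}S_{i,m}]$. The process $X(t)=Y_0S_0(t)+Y_1S_1(t)$ is the mean square solution of $\ddot X+A\dot X+BX=0$, $X(t_0)=Y_0$, $\dot X(t_0)=Y_1$. $S_i^N(t)=\sum_{n=0}^NS_{i,n}(t-t_0)^n$ are the partial sums, and $X^N(t)=Y_0S_0^N(t)+Y_1S_1^N(t)$. $\delta\in(0,r]$ is a number such that $|S_0(t)-1|<1/4$ for all $t\in(t_0-\delta,t_0+\delta)$ (it exists since $S_0(t_0)=1$ and $S_0$ is continuous); hence $S_0(t)>3/4$ there. For $t\in(t_0-\delta,t_0+\delta)$, $N_t$ is a positive integer such that $|S_0^N(t)-S_0(t)|<1/4$ for all $N\ge N_t$, so that $S_0^N(t)>1/2$ for $N\ge N_t$. The densities of $X(t)$ and of $X^N(t)$ ($N\ge N_t$) are the functions $$f_{X(t)}(x)=\mathbb{E}\left[f_{Y_0}\left(\tfrac{x-Y_1S_1(t)}{S_0(t)}\right)\tfrac{1}{|S_0(t)|}\right],\qquad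 f_{X^N(t)}(x)=\mathbb{E}\left[f_{Y_0}\left(\tfrac{x-Y_1S_1^N(t)}{S_0^N(t)}\right)\tfrac{1}{|S_0^N(t)|}\right].$$ *)

theory Defs
  imports "HOL-Probability.Probability"
begin

text \<open>
  Coefficients of the power series solutions of \<open>x'' + A x' + B x = 0\<close> around \<open>t\<^sub>0\<close>,
  where \<open>s0\<close> and \<open>s1\<close> are the prescribed values of the solution and of its derivative at \<open>t\<^sub>0\<close>.
\<close>

function sol_coeff :: "(nat \<Rightarrow> real) \<Rightarrow> (nat \<Rightarrow> real) \<Rightarrow> real \<Rightarrow> real \<Rightarrow> nat \<Rightarrow> real" where
  "sol_coeff A B s0 s1 0 = s0"
| "sol_coeff A B s0 s1 (Suc 0) = s1"
| "sol_coeff A B s0 s1 (Suc (Suc n)) =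
     - 1 / ((real n + 2) * (real n + 1)) *
       (\<Sum>m = 0..n. (real m + 1) * A (n - m) * sol_coeff A B s0 s1 (m + 1)
                    + B (n - m) * sol_coeff A B s0 s1 m)"
  by pat_completeness auto
termination
  by (relation "Wellfounded.measure (\<lambda>(A, B, s0, s1, n). n)") auto

definition S0_coeff :: "(nat \<Rightarrow> real) \<Rightarrow> (nat \<Rightarrow> real) \<Rightarrow> nat \<Rightarrow> real" where
  "S0_coeff A B = sol_coeff A B 1 0"

definition S1_coeff :: "(nat \<Rightarrow> real) \<Rightarrow> (nat \<Rightarrow> real) \<Rightarrow> nat \<Rightarrow> real" where
  "S1_coeff A B = sol_coeff A B 0 1"

definition pseries :: "(nat \<Rightarrow> real) \<Rightarrow> real \<Rightarrow> real \<Rightarrow> real" where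
  "pseries c t0 t = (\<Sum>n. c n * (t - t0) ^ n)"

definition pseries_partial :: "(nat \<Rightarrow> real) \<Rightarrow> real \<Rightarrow> nat \<Rightarrow> real \<Rightarrow> real" where
  "pseries_partial c t0 N t = (\<Sum>n = 0..N. c n * (t - t0) ^ n)"

definition L2_rv :: "'a measure \<Rightarrow> ('a \<Rightarrow> real) \<Rightarrow> bool" where
  "L2_rv M Y \<longleftrightarrow> Y \<in> borel_measurable M \<and> integrable M (\<lambda>\<omega>. (Y \<omega>)\<^sup>2)"

definition discrete_rv :: "'a measure \<Rightarrow> ('a \<Rightarrow> real) \<Rightarrow> bool" where
  "discrete_rv M Y \<longleftrightarrow>
     Y \<in> borel_measurable M \<and> (\<exists>C. countable C \<and> (AE \<omega> in M. Y \<omega> \<in> C))"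

definition dens_X ::
  "'a measure \<Rightarrow> (real \<Rightarrow> real) \<Rightarrow> ('a \<Rightarrow> real) \<Rightarrow> (nat \<Rightarrow> real) \<Rightarrow> (nat \<Rightarrow> real)
     \<Rightarrow> real \<Rightarrow> real \<Rightarrow> real \<Rightarrow> real" where
  "dens_X M f Y1 A B t0 t x =
     (LINT \<omega>|M. f ((x - Y1 \<omega> * pseries (S1_coeff A B) t0 t) / pseries (S0_coeff A B) t0 t)
                 * (1 / \<bar>pseries (S0_coeff A B) t0 t\<bar>))"

text \<open>
  The function below is the density of \<open>X\<^sup>N(t)\<close> only for those \<open>N\<close> with \<open>S\<^sub>0\<^sup>N(t) \<noteq> 0\<close>, that is,
  for all sufficiently large \<open>N\<close>; the other values are irrelevant for limits as \<open>N\<close> tends to infinity.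
\<close>

definition dens_XN ::
  "'a measure \<Rightarrow> (real \<Rightarrow> real) \<Rightarrow> ('a \<Rightarrow> real) \<Rightarrow> (nat \<Rightarrow> real) \<Rightarrow> (nat \<Rightarrow> real)
     \<Rightarrow> real \<Rightarrow> nat \<Rightarrow> real \<Rightarrow> real \<Rightarrow> real" where
  "dens_XN M f Y1 A B t0 N t x =
     (LINT \<omega>|M. f ((x - Y1 \<omega> * pseries_partial (S1_coeff A B) t0 N t)
                     / pseries_partial (S0_coeff A B) t0 N t)
                 * (1 / \<bar>pseries_partial (S0_coeff A B) t0 N t\<bar>))"

end

theory Submission
  imports Defs
begin

text \<open>
  Fix \<open>t\<close>. Passing from \<open>X\<^sup>N(t)\<close> to \<open>X(t)\<close> only replaces the two numbers
  \<open>a\<^sub>N = S\<^sub>0\<^sup>N(t)\<close> and \<open>b\<^sub>N = S\<^sub>1\<^sup>N(t)\<close> by their limits \<open>a\<close> and \<open>b\<close>, and \<open>a \<noteq> 0\<close> since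
  \<open>\<bar>a - 1\<bar> < 1/4\<close>. The claim is therefore a convergence of integrals of
  \<open>f ((x - Y\<^sub>1 b\<^sub>N) / a\<^sub>N) / \<bar>a\<^sub>N\<bar>\<close>.

  The integrands converge as soon as \<open>f\<close> is continuous at \<open>(x - Y\<^sub>1 b) / a\<close>. If \<open>Y\<^sub>1\<close> takes its
  values in the countable set \<open>C\<close> and \<open>D\<close> is the countable set of discontinuities of \<open>f\<close>, this
  can only fail for \<open>x\<close> in the set of all \<open>c b + d a\<close> with \<open>c \<in> C\<close> and \<open>d \<in> D\<close>. That set is
  countable, hence Lebesgue null. The quadratic growth of \<open>f\<close> bounds the integrands by an affine
  function of \<open>Y\<^sub>1\<^sup>2\<close>, which is integrable, so dominated convergence applies: this is
  \<open>affine_density_tendsto\<close>.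

  It remains to know that \<open>S\<^sub>0\<close> and \<open>S\<^sub>1\<close> converge at \<open>t\<close>, which is the classical theorem on power
  series solutions at an ordinary point (\<open>sol_coeff_summable\<close>). For \<open>0 \<le> h < r\<close> the
  recursion, together with the geometric decay of \<open>A\<^sub>k h\<^sup>k\<close> and \<open>B\<^sub>k h\<^sup>k\<close>, bounds
  \<open>\<bar>S\<^sub>n\<^sub>+\<^sub>2\<bar> h\<^sup>n\<^sup>+\<^sup>2\<close> by \<open>L / (n + 2)\<close> times the maximum of the earlier terms. From \<open>n + 2 \<ge> L\<close> on the
  running maximum no longer grows, so the terms stay bounded for every such \<open>h\<close>, and Abel's lemma
  gives convergence.
\<close>

section \<open>Convergence of the power series solutions\<close>

lemma bounded_if_eventually_below_running_max:
  fixes b :: "nat \<Rightarrow> real"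
  assumes step: "\<And>n M. n \<ge> n0 \<Longrightarrow> 0 \<le> M \<Longrightarrow> (\<And>m. m < n \<Longrightarrow> b m \<le> M) \<Longrightarrow> b n \<le> M"
  shows "\<exists>M\<ge>0. \<forall>n. b n \<le> M"
proof -
  define M where "M = Max (insert 0 (b ` {..<n0}))"
  have M0: "0 \<le> M" and Mb: "\<And>m. m < n0 \<Longrightarrow> b m \<le> M"
    by (auto simp: M_def)
  have "b n \<le> M" for n
    by (induction n rule: less_induct) (metis Mb M0 step not_less)
  with M0 show ?thesis by blast
qed

text \<open>
  Terms that are bounded at a radius \<open>\<rho>\<close> decay geometrically at every smaller radius. This turns
  the Cauchy products in the recursion into geometric sums.
\<close>

lemma summable_powser_coeff_geometric_decay:
  fixes c :: "nat \<Rightarrow> real"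
  assumes "summable (\<lambda>n. c n * \<rho> ^ n)" "0 < \<rho>" "0 \<le> h"
  obtains K where "0 \<le> K" "\<And>n. \<bar>c n\<bar> * h ^ n \<le> K * (h / \<rho>) ^ n"
proof -
  have "Bseq (\<lambda>n. c n * \<rho> ^ n)"
    using assms(1) summable_LIMSEQ_zero convergent_imp_Bseq convergentI by blast
  then obtain K where K: "0 < K" "\<And>n. norm (c n * \<rho> ^ n) \<le> K"
    by (auto elim: BseqE)
  have "\<bar>c n\<bar> * h ^ n \<le> K * (h / \<rho>) ^ n" for n
  proof -
    have "\<bar>c n\<bar> * h ^ n = norm (c n * \<rho> ^ n) * (h / \<rho>) ^ n"
      using assms by (simp add: abs_mult power_divide)
    also have "\<dots> \<le> K * (h / \<rho>) ^ n"
      using K assms by (intro mult_right_mono) auto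
    finally show ?thesis .
  qed
  with K show ?thesis by (intro that[of K]) auto
qed

lemma sum_geometric_reversed_le:
  fixes q :: real
  assumes "0 \<le> q" "q < 1"
  shows "(\<Sum>m = 0..n. q ^ (n - m)) \<le> 1 / (1 - q)"
proof -
  have "(\<Sum>m = 0..n. q ^ (n - m)) = (\<Sum>m\<le>n. q ^ m)"
    using sum.atLeastAtMost_rev[of "\<lambda>m. q ^ m" 0 n] by (simp add: atLeast0AtMost)
  also have "\<dots> = (1 - q ^ Suc n) / (1 - q)"
    using assms by (simp add: sum_gp0)
  also have "\<dots> \<le> 1 / (1 - q)"
    using assms by (intro divide_right_mono) auto
  finally show ?thesis .
qed

text \<open>
  The factor \<open>(n + 2)(n + 1)\<close> coming from the second derivative beats the factor \<open>m + 1 \<le> n + 1\<close>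
  coming from the first derivative by one order, which leaves the decisive gain \<open>1 / (n + 2)\<close>.
\<close>

lemma sol_coeff_step_bound:
  fixes A B :: "nat \<Rightarrow> real"
  assumes A: "\<And>k. \<bar>A k\<bar> * h ^ k \<le> K * q ^ k" and B: "\<And>k. \<bar>B k\<bar> * h ^ k \<le> K * q ^ k"
    and h: "0 \<le> h" and K: "0 \<le> K" and q: "0 \<le> q" "q < 1" and M: "0 \<le> M"
    and prev: "\<And>m. m < n + 2 \<Longrightarrow> \<bar>sol_coeff A B s0 s1 m\<bar> * h ^ m \<le> M"
  shows "\<bar>sol_coeff A B s0 s1 (n + 2)\<bar> * h ^ (n + 2) \<le> K * (h + h\<^sup>2) / (1 - q) / (real n + 2) * M"
proof -
  let ?S = "sol_coeff A B s0 s1"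
  let ?T = "\<lambda>m. (real m + 1) * A (n - m) * ?S (m + 1) + B (n - m) * ?S m"
  define W where "W = K * (h + h\<^sup>2) * M * (real n + 1)"
  have W: "0 \<le> W" unfolding W_def using K h M by simp
  have term_bound: "\<bar>?T m\<bar> * h ^ (n + 2) \<le> W * q ^ (n - m)" if m: "m \<in> {0..n}" for m
  proof -
    \<comment> \<open>Each index of the Cauchy product gets its own power of \<open>h\<close>. The total index of a summand
      is \<open>n + 1\<close> for \<open>A\<close> and \<open>n\<close> for \<open>B\<close>, which leaves the factors \<open>h\<close> and \<open>h\<^sup>2\<close>.\<close>
    have pow: "h ^ (n + 2) = h ^ (n - m) * h * h ^ (m + 1)" "h ^ (n + 2) = h ^ (n - m) * h\<^sup>2 * h ^ m"
      using m by (simp_all flip: power_add power_Suc power_Suc2)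
    have "\<bar>?T m\<bar> * h ^ (n + 2)
        \<le> ((real m + 1) * \<bar>A (n - m)\<bar> * \<bar>?S (m + 1)\<bar> + \<bar>B (n - m)\<bar> * \<bar>?S m\<bar>) * h ^ (n + 2)"
      using h by (intro mult_right_mono order_trans[OF abs_triangle_ineq]) (auto simp: abs_mult)
    also have "\<dots> = (real m + 1) * h * (\<bar>A (n - m)\<bar> * h ^ (n - m)) * (\<bar>?S (m + 1)\<bar> * h ^ (m + 1))
        + h\<^sup>2 * (\<bar>B (n - m)\<bar> * h ^ (n - m)) * (\<bar>?S m\<bar> * h ^ m)"
    proof -
      have "(real m + 1) * \<bar>A (n - m)\<bar> * \<bar>?S (m + 1)\<bar> * h ^ (n + 2)
          = (real m + 1) * h * (\<bar>A (n - m)\<bar> * h ^ (n - m)) * (\<bar>?S (m + 1)\<bar> * h ^ (m + 1))"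
        unfolding pow(1) by (simp only: mult_ac)
      moreover have "\<bar>B (n - m)\<bar> * \<bar>?S m\<bar> * h ^ (n + 2)
          = h\<^sup>2 * (\<bar>B (n - m)\<bar> * h ^ (n - m)) * (\<bar>?S m\<bar> * h ^ m)"
        unfolding pow(2) by (simp only: mult_ac)
      ultimately show ?thesis by (subst distrib_right) (rule arg_cong2[where f = "(+)"])
    qed
    also have "\<dots> \<le> (real n + 1) * h * (K * q ^ (n - m)) * M
        + (h\<^sup>2 * (real n + 1)) * (K * q ^ (n - m)) * M"
    proof (intro add_mono)
      show "(real m + 1) * h * (\<bar>A (n - m)\<bar> * h ^ (n - m)) * (\<bar>?S (m + 1)\<bar> * h ^ (m + 1))
          \<le> (real n + 1) * h * (K * q ^ (n - m)) * M"
        by (rule mult_mono[OF mult_mono[OF mult_right_mono A] prev]) (use m h K q in auto)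
      have "h\<^sup>2 * 1 \<le> h\<^sup>2 * (real n + 1)"
        by (rule mult_left_mono) auto
      then show "h\<^sup>2 * (\<bar>B (n - m)\<bar> * h ^ (n - m)) * (\<bar>?S m\<bar> * h ^ m)
          \<le> (h\<^sup>2 * (real n + 1)) * (K * q ^ (n - m)) * M"
        by (intro mult_mono[OF mult_mono[OF _ B] prev]) (use m h K q in auto)
    qed
    also have "\<dots> = W * q ^ (n - m)"
      by (simp add: W_def algebra_simps)
    finally show ?thesis .
  qed
  have "\<bar>?S (n + 2)\<bar> * h ^ (n + 2)
      = \<bar>\<Sum>m = 0..n. ?T m\<bar> * h ^ (n + 2) / ((real n + 2) * (real n + 1))"
    by (simp add: abs_mult)
  also have "\<dots> \<le> (\<Sum>m = 0..n. \<bar>?T m\<bar> * h ^ (n + 2)) / ((real n + 2) * (real n + 1))"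
    unfolding sum_distrib_right[symmetric] using h
    by (intro divide_right_mono mult_right_mono sum_abs) auto
  also have "\<dots> \<le> (\<Sum>m = 0..n. W * q ^ (n - m)) / ((real n + 2) * (real n + 1))"
    using term_bound by (intro divide_right_mono sum_mono) auto
  also have "\<dots> \<le> W * (1 / (1 - q)) / ((real n + 2) * (real n + 1))"
    unfolding sum_distrib_left[symmetric] using W sum_geometric_reversed_le[OF q]
    by (intro divide_right_mono mult_left_mono) auto
  also have "\<dots> = K * (h + h\<^sup>2) / (1 - q) / (real n + 2) * M"
    using q by (simp add: W_def)
  finally show ?thesis .
qed

text \<open>
  The bound of the previous lemma is at most the running maximum once \<open>n + 2\<close> exceeds the constant
  \<open>L = K (h + h\<^sup>2) / (1 - h / \<rho>)\<close>.
\<close>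

lemma sol_coeff_terms_bounded:
  fixes A B :: "nat \<Rightarrow> real"
  assumes "summable (\<lambda>n. A n * \<rho> ^ n)" "summable (\<lambda>n. B n * \<rho> ^ n)" "0 \<le> h" "h < \<rho>"
  shows "\<exists>M\<ge>0. \<forall>n. \<bar>sol_coeff A B s0 s1 n\<bar> * h ^ n \<le> M"
proof -
  define q where "q = h / \<rho>"
  have q: "0 \<le> q" "q < 1" using assms by (auto simp: q_def)
  obtain KA where KA: "0 \<le> KA" "\<And>k. \<bar>A k\<bar> * h ^ k \<le> KA * q ^ k"
    using summable_powser_coeff_geometric_decay[OF assms(1)] assms(3,4) unfolding q_def by auto
  obtain KB where KB: "0 \<le> KB" "\<And>k. \<bar>B k\<bar> * h ^ k \<le> KB * q ^ k"
    using summable_powser_coeff_geometric_decay[OF assms(2)] assms(3,4) unfolding q_def by auto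
  define K where "K = max KA KB"
  have K: "0 \<le> K" using KA by (simp add: K_def)
  have AK: "\<bar>A k\<bar> * h ^ k \<le> K * q ^ k" for k
    by (rule order_trans[OF KA(2)], rule mult_right_mono) (use q in \<open>auto simp: K_def\<close>)
  have BK: "\<bar>B k\<bar> * h ^ k \<le> K * q ^ k" for k
    by (rule order_trans[OF KB(2)], rule mult_right_mono) (use q in \<open>auto simp: K_def\<close>)
  define L where "L = K * (h + h\<^sup>2) / (1 - q)"
  show ?thesis
  proof (rule bounded_if_eventually_below_running_max[where ?n0.0 = "max 2 (nat \<lceil>L\<rceil>)"])
    fix n M
    assume n: "max 2 (nat \<lceil>L\<rceil>) \<le> n" and M: "0 \<le> (M::real)"
      and prev: "\<And>m. m < n \<Longrightarrow> \<bar>sol_coeff A B s0 s1 m\<bar> * h ^ m \<le> M"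
    obtain k where k: "n = k + 2" using n by (metis add.commute le_Suc_ex max.bounded_iff)
    have "\<bar>sol_coeff A B s0 s1 n\<bar> * h ^ n \<le> L / (real k + 2) * M"
      unfolding k L_def using prev k
      by (intro sol_coeff_step_bound AK BK \<open>0 \<le> h\<close> K q M) auto
    also have "\<dots> \<le> 1 * M"
    proof (rule mult_right_mono)
      have "L \<le> real k + 2" using n unfolding k by linarith
      then show "L / (real k + 2) \<le> 1" by simp
    qed (rule M)
    finally show "\<bar>sol_coeff A B s0 s1 n\<bar> * h ^ n \<le> M" by simp
  qed
qed

text \<open>
  Two intermediate radii \<open>\<bar>t - t0\<bar> < h < \<rho> < r\<close> are needed: the room between \<open>h\<close> and \<open>\<rho>\<close> gives
  the geometric decay of \<open>A\<close> and \<open>B\<close>, and the room between \<open>\<bar>t - t0\<bar>\<close> and \<open>h\<close> turns bounded terms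
  into an absolutely convergent series.
\<close>

theorem sol_coeff_summable:
  fixes A B :: "nat \<Rightarrow> real"
  assumes A: "\<And>s. s \<in> {t0 - r<..<t0 + r} \<Longrightarrow> summable (\<lambda>n. A n * (s - t0) ^ n)"
    and B: "\<And>s. s \<in> {t0 - r<..<t0 + r} \<Longrightarrow> summable (\<lambda>n. B n * (s - t0) ^ n)"
    and t: "t \<in> {t0 - r<..<t0 + r}"
  shows "summable (\<lambda>n. sol_coeff A B s0 s1 n * (t - t0) ^ n)"
proof -
  have "\<bar>t - t0\<bar> < r" using t by auto
  then obtain h where h: "\<bar>t - t0\<bar> < h" "h < r" using dense by blast
  then have "0 \<le> h" by linarith
  obtain \<rho> where \<rho>: "h < \<rho>" "\<rho> < r" using dense[OF h(2)] by blast
  have "summable (\<lambda>n. A n * \<rho> ^ n)" "summable (\<lambda>n. B n * \<rho> ^ n)"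
    using A[of "t0 + \<rho>"] B[of "t0 + \<rho>"] h \<rho> by auto
  from sol_coeff_terms_bounded[OF this \<open>0 \<le> h\<close> \<rho>(1)]
  obtain M where M: "\<And>n. \<bar>sol_coeff A B s0 s1 n\<bar> * h ^ n \<le> M" by metis
  have "summable (\<lambda>n. norm (sol_coeff A B s0 s1 n) * \<bar>t - t0\<bar> ^ n)"
    by (rule Abel_lemma[OF abs_ge_zero h(1), where M = M]) (simp only: real_norm_def M)
  then have "summable (\<lambda>n. norm (sol_coeff A B s0 s1 n * (t - t0) ^ n))"
    by (simp only: abs_mult power_abs real_norm_def)
  then show ?thesis by (rule summable_norm_cancel)
qed

lemma pseries_partial_tendsto:
  assumes "summable (\<lambda>n. c n * (t - t0) ^ n)"
  shows "(\<lambda>N. pseries_partial c t0 N t) \<longlonglongrightarrow> pseries c t0 t"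
  using summable_LIMSEQ'[OF assms]
  by (simp add: pseries_partial_def pseries_def atLeast0AtMost)

section \<open>Limits of the densities\<close>

lemma AE_lborel_avoids_countable_affine_image:
  fixes a b :: real
  assumes "countable C" "countable D" "a \<noteq> 0"
  shows "AE x in lborel. \<forall>c\<in>C. (x - c * b) / a \<notin> D"
proof -
  have "countable ((\<lambda>(c, d). c * b + d * a) ` (C \<times> D))"
    using assms by blast
  then have "AE x in lborel. x \<notin> (\<lambda>(c, d). c * b + d * a) ` (C \<times> D)"
    by (intro AE_not_in countable_imp_null_set_lborel)
  then show ?thesis
  proof eventually_elim
    case (elim x)
    have "x = c * b + (x - c * b) / a * a" for c using assms(3) by simp
    with elim show ?case by (force simp: image_iff)
  qed
qed

text \<open>
  The right-hand side no longer involves \<open>a\<close> and \<open>b\<close> and is affine in \<open>y\<^sup>2\<close>: one integrable function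
  dominates the integrands for all \<open>a\<close> bounded away from zero and all bounded \<open>b\<close>.
\<close>

lemma quadratic_growth_affine_bound:
  fixes f :: "real \<Rightarrow> real"
  assumes f: "f ((x - y * b) / a) \<le> \<alpha> + \<beta> * ((x - y * b) / a)\<^sup>2"
    and "0 \<le> \<alpha>" "0 \<le> \<beta>" "0 < c" "c \<le> \<bar>a\<bar>" "\<bar>b\<bar> \<le> k"
  shows "f ((x - y * b) / a) * (1 / \<bar>a\<bar>) \<le> (\<alpha> + \<beta> * ((2 * x\<^sup>2 + 2 * k\<^sup>2 * y\<^sup>2) / c\<^sup>2)) * (1 / c)"
proof (rule mult_mono)
  have "(x - y * b)\<^sup>2 \<le> 2 * x\<^sup>2 + 2 * (y * b)\<^sup>2"
    using zero_le_power2[of "x + y * b"] by (simp add: power2_eq_square algebra_simps)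
  also have "(y * b)\<^sup>2 = b\<^sup>2 * y\<^sup>2"
    by (simp add: power_mult_distrib)
  also have "b\<^sup>2 * y\<^sup>2 \<le> k\<^sup>2 * y\<^sup>2"
    using assms power_mono[of "\<bar>b\<bar>" k 2] by (intro mult_right_mono) auto
  finally have num: "(x - y * b)\<^sup>2 \<le> 2 * x\<^sup>2 + 2 * k\<^sup>2 * y\<^sup>2" by simp
  have "c\<^sup>2 \<le> a\<^sup>2"
    using assms power_mono[of c "\<bar>a\<bar>" 2] by simp
  then have "((x - y * b) / a)\<^sup>2 \<le> (2 * x\<^sup>2 + 2 * k\<^sup>2 * y\<^sup>2) / c\<^sup>2"
    unfolding power_divide using num assms by (intro frac_le) auto
  then show "f ((x - y * b) / a) \<le> \<alpha> + \<beta> * ((2 * x\<^sup>2 + 2 * k\<^sup>2 * y\<^sup>2) / c\<^sup>2)"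
    using f assms by (smt (verit) mult_left_mono)
qed (use assms in \<open>auto simp: frac_le\<close>)

theorem affine_density_tendsto:
  fixes f :: "real \<Rightarrow> real" and Y :: "'a \<Rightarrow> real" and a b :: "nat \<Rightarrow> real"
  assumes "finite_measure M"
    and f_meas: "f \<in> borel_measurable borel" and f_nonneg: "\<And>y. 0 \<le> f y"
    and f_growth: "\<And>y. f y \<le> \<alpha> + \<beta> * y\<^sup>2" and "0 \<le> \<alpha>" "0 \<le> \<beta>"
    and f_cont: "countable {y. \<not> isCont f y}"
    and Y_L2: "L2_rv M Y" and Y_discrete: "discrete_rv M Y"
    and a: "a \<longlonglongrightarrow> a'" "a' \<noteq> 0" and b: "b \<longlonglongrightarrow> b'"
  shows "AE x in lborel. (\<lambda>N. LINT \<omega>|M. f ((x - Y \<omega> * b N) / a N) * (1 / \<bar>a N\<bar>))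
           \<longlonglongrightarrow> (LINT \<omega>|M. f ((x - Y \<omega> * b') / a') * (1 / \<bar>a'\<bar>))"
proof -
  interpret finite_measure M by fact
  have Y_meas[measurable]: "Y \<in> borel_measurable M" and Y2: "integrable M (\<lambda>\<omega>. (Y \<omega>)\<^sup>2)"
    using Y_L2 by (auto simp: L2_rv_def)
  note f_meas[measurable]
  obtain C where C: "countable C" "AE \<omega> in M. Y \<omega> \<in> C"
    using Y_discrete by (auto simp: discrete_rv_def)
  define c where "c = \<bar>a'\<bar> / 2"
  have c: "0 < c" using a by (simp add: c_def)
  have "(\<lambda>N. \<bar>a N\<bar>) \<longlonglongrightarrow> \<bar>a'\<bar>" using a by (intro tendsto_rabs)
  then have "\<forall>\<^sub>F N in sequentially. c < \<bar>a N\<bar>"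
    using a by (intro order_tendstoD(1)) (auto simp: c_def)
  then obtain N0 where N0: "\<And>N. N \<ge> N0 \<Longrightarrow> c < \<bar>a N\<bar>"
    by (auto simp: eventually_sequentially)
  have "Bseq b" using b by (intro convergent_imp_Bseq convergentI)
  then obtain k where k: "\<And>N. \<bar>b N\<bar> \<le> k" by (auto simp: Bseq_def)
  show ?thesis
    using AE_lborel_avoids_countable_affine_image[OF C(1) f_cont a(2), of b']
  proof eventually_elim
    case (elim x)
    let ?g = "\<lambda>N \<omega>. f ((x - Y \<omega> * b N) / a N) * (1 / \<bar>a N\<bar>)"
    let ?g' = "\<lambda>\<omega>. f ((x - Y \<omega> * b') / a') * (1 / \<bar>a'\<bar>)"
    let ?w = "\<lambda>\<omega>. (\<alpha> + \<beta> * ((2 * x\<^sup>2 + 2 * k\<^sup>2 * (Y \<omega>)\<^sup>2) / c\<^sup>2)) * (1 / c)"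
    \<comment> \<open>Only the tail from \<open>N0\<close> on is dominated, because an early \<open>a N\<close> may be close to zero.\<close>
    have "(\<lambda>N. integral\<^sup>L M (?g (N + N0))) \<longlonglongrightarrow> integral\<^sup>L M ?g'"
    proof (rule integral_dominated_convergence[where w = ?w])
      show "integrable M ?w"
        using Y2 by (intro integrable_mult_left integrable_add integrable_mult_right
            integrable_divide integrable_const) auto
      show "AE \<omega> in M. (\<lambda>N. ?g (N + N0) \<omega>) \<longlonglongrightarrow> ?g' \<omega>"
        using C(2)
      proof eventually_elim
        case (elim \<omega>)
        then have "isCont f ((x - Y \<omega> * b') / a')"
          using \<open>\<forall>c\<in>C. (x - c * b') / a' \<notin> {y. \<not> isCont f y}\<close> by blast
        then have "(\<lambda>N. ?g N \<omega>) \<longlonglongrightarrow> ?g' \<omega>"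
          using a b by (intro tendsto_intros isCont_tendsto_compose[where g = f]) auto
        then show ?case by (rule LIMSEQ_ignore_initial_segment)
      qed
      show "AE \<omega> in M. norm (?g (N + N0) \<omega>) \<le> ?w \<omega>" for N
      proof (rule AE_I2)
        fix \<omega>
        have "?g (N + N0) \<omega> \<le> ?w \<omega>"
          using N0[of "N + N0"] k c assms(5,6) f_growth
          by (intro quadratic_growth_affine_bound) auto
        then show "norm (?g (N + N0) \<omega>) \<le> ?w \<omega>"
          using f_nonneg by simp
      qed
    qed measurable
    then show ?case by (rule LIMSEQ_offset)
  qed
qed

theorem theorem3p12:
  fixes M :: "'a measure"
    and t0 r \<delta> t \<alpha> \<beta> :: real
    and A B :: "nat \<Rightarrow> real"
    and Y0 Y1 :: "'a \<Rightarrow> real"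
    and f :: "real \<Rightarrow> real"
  assumes "prob_space M" and "complete_measure M"
    and "r > 0"
    and "\<And>s. s \<in> {t0 - r<..<t0 + r} \<Longrightarrow> summable (\<lambda>n. A n * (s - t0) ^ n)"
    and "\<And>s. s \<in> {t0 - r<..<t0 + r} \<Longrightarrow> summable (\<lambda>n. B n * (s - t0) ^ n)"
    and "L2_rv M Y0" and "L2_rv M Y1"
    and "\<And>y. f y \<ge> 0"
    and "distributed M lborel Y0 (\<lambda>y. ennreal (f y))"
    and "prob_space.indep_var M borel Y0 borel Y1"
    and "countable {y. \<not> isCont f y}"
    and "\<alpha> \<ge> 0" and "\<beta> \<ge> 0" and "\<And>y. f y \<le> \<alpha> + \<beta> * y\<^sup>2"
    and "discrete_rv M Y1"
    and "0 < \<delta>" and "\<delta> \<le> r"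
    and "\<And>s. s \<in> {t0 - \<delta><..<t0 + \<delta>} \<Longrightarrow> \<bar>pseries (S0_coeff A B) t0 s - 1\<bar> < 1 / 4"
    and "t \<in> {t0 - \<delta><..<t0 + \<delta>}"
  shows "AE x in lborel. (\<lambda>N. dens_XN M f Y1 A B t0 N t x) \<longlonglongrightarrow> dens_X M f Y1 A B t0 t x"
proof -
  have s: "t \<in> {t0 - r<..<t0 + r}" using assms(17,19) by auto
  have S0: "(\<lambda>N. pseries_partial (S0_coeff A B) t0 N t) \<longlonglongrightarrow> pseries (S0_coeff A B) t0 t"
    unfolding S0_coeff_def using sol_coeff_summable[OF assms(4,5) s]
    by (rule pseries_partial_tendsto)
  have S1: "(\<lambda>N. pseries_partial (S1_coeff A B) t0 N t) \<longlonglongrightarrow> pseries (S1_coeff A B) t0 t"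
    unfolding S1_coeff_def using sol_coeff_summable[OF assms(4,5) s]
    by (rule pseries_partial_tendsto)
  have nz: "pseries (S0_coeff A B) t0 t \<noteq> 0"
    using assms(18)[OF assms(19)] by auto
  have "(\<lambda>y. enn2real (ennreal (f y))) \<in> borel_measurable borel"
    using measurable_compose[OF distributed_borel_measurable[OF assms(9)] borel_measurable_enn2real]
    by simp
  then have f: "f \<in> borel_measurable borel" using assms(8) by simp
  show ?thesis
    unfolding dens_XN_def dens_X_def
    by (rule affine_density_tendsto[OF prob_space.finite_measure[OF assms(1)] f assms(8)
          assms(14,12,13,11,7,15) S0 nz S1])
qed

end
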